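(* For every integer $d\geq 3$ there exist $d$-dimensional lattice polytopes $P_1,P_2,P_3,P_4$ such that: (1) $P_1$ is both Ehrhart positive and Ehrhart unimodal; (2) $P_2$ is Ehrhart positive but not Ehrhart unimodal; (3) $P_3$ is Ehrhart unimodal but not Ehrhart positive; (4) $P_4$ is neither Ehrhart positive nor Ehrhart unimodal.
   Context: A lattice polytope is the convex hull in $\mathbb{R}^n$ of finitely many points of $\mathbb{Z}^n$; its dimension $d$ is the dimension of its affine span. For a $d$-dimensional lattice polytope $P\subset\mathbb{R}^n$ and $t\in\mathbb{Z}_{\geq 0}$, let $tP=\{tp : p\in P\}$ and $i(P;t)=|tP\cap\mathbb{Z}^n|$; this is a polynomial in $t$ of degree $d$ (the Ehrhart polynomial). The $h^\ast$-polynomial $h^\ast(P;z)=h_0^\ast+h_1^\ast z+\cdots+h_d^\ast z^d$ is defined by $\sum_{t\geq 0} i(P;t)z^t = h^\ast(P;z)/(1-z)^{d+1}$. $P$ is Ehrhart positive if all coefficients (of $t^0,\dots,t^d$) of $i(P;t)$ are positive (strictly greater than $0$). $P$ is Ehrhart unimodal if there is an index $m\in\{0,1,\ldots,d\}$ with $h_0^\ast\leq\cdots\leq h_m^\ast\geq\cdots\geq h_d^\ast$. *)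

theory Defs
  imports
    "HOL-Analysis.Analysis"
    "HOL-Computational_Algebra.Polynomial_FPS"
begin

definition integer_points :: "(real ^ 'n) set"
  where "integer_points = {x. \<forall>i. x $ i \<in> \<int>}"

definition lattice_polytope :: "(real ^ 'n) set \<Rightarrow> bool"
  where "lattice_polytope P \<longleftrightarrow>
    (\<exists>S. finite S \<and> S \<subseteq> integer_points \<and> P = convex hull S)"

definition ehrhart_count :: "(real ^ 'n) set \<Rightarrow> nat \<Rightarrow> nat"
  where "ehrhart_count P t = card ((\<lambda>p. real t *\<^sub>R p) ` P \<inter> integer_points)"

text \<open>
  The library's \<open>aff_dim\<close> is an integer, with value \<open>-1\<close> exactly for the empty set.
\<close>

definition polytope_dim :: "(real ^ 'n) set \<Rightarrow> nat"
  where "polytope_dim P = nat (aff_dim P)"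

text \<open>
  The polynomial below exists for every lattice polytope by Ehrhart's theorem; that there is
  at most one is part of lemma \<open>ehrhart_poly_eqI\<close>.
\<close>

definition ehrhart_poly :: "(real ^ 'n) set \<Rightarrow> real poly"
  where "ehrhart_poly P = (THE p. \<forall>t. poly p (real t) = real (ehrhart_count P t))"

definition hstar_poly :: "(real ^ 'n) set \<Rightarrow> real poly"
  where "hstar_poly P = (THE h. degree h \<le> polytope_dim P \<and>
    Abs_fps (\<lambda>t. real (ehrhart_count P t)) =
      fps_of_poly h / (1 - fps_X) ^ (polytope_dim P + 1))"

definition ehrhart_positive :: "(real ^ 'n) set \<Rightarrow> bool"
  where "ehrhart_positive P \<longleftrightarrow> (\<forall>k \<le> polytope_dim P. coeff (ehrhart_poly P) k > 0)"

definition ehrhart_unimodal :: "(real ^ 'n) set \<Rightarrow> bool"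
  where "ehrhart_unimodal P \<longleftrightarrow>
    (\<exists>m \<le> polytope_dim P.
      (\<forall>j < m. coeff (hstar_poly P) j \<le> coeff (hstar_poly P) (j + 1)) \<and>
      (\<forall>j. m \<le> j \<and> j < polytope_dim P \<longrightarrow>
        coeff (hstar_poly P) j \<ge> coeff (hstar_poly P) (j + 1)))"

lemma ehrhart_poly_eqI:
  assumes "\<And>t. poly p (real t) = real (ehrhart_count P t)"
  shows "ehrhart_poly P = p"
  unfolding ehrhart_poly_def
proof (rule the_equality)
  show "\<forall>t. poly p (real t) = real (ehrhart_count P t)"
    using assms by blast
next
  fix q assume q: "\<forall>t. poly q (real t) = real (ehrhart_count P t)"
  have "range real \<subseteq> {x. poly (q - p) x = 0}"
    using q assms by auto
  moreover have "infinite (range real)"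
    by (simp add: finite_image_iff inj_on_def)
  ultimately have "infinite {x. poly (q - p) x = 0}"
    using finite_subset by blast
  then show "q = p"
    using poly_roots_finite[of "q - p"] by auto
qed

lemma fps_divide_right_cancel:
  fixes A B D :: "real fps"
  assumes "fps_nth D 0 \<noteq> 0" and "A / D = B / D"
  shows "A = B"
proof -
  have "C / D * D = C" for C :: "real fps"
    using assms(1) by (simp add: fps_divide_unit mult.assoc inverse_mult_eq_1)
  then show ?thesis
    using assms(2) by metis
qed

lemma hstar_poly_eqI:
  assumes "degree h \<le> polytope_dim P"
    and "Abs_fps (\<lambda>t. real (ehrhart_count P t)) =
      fps_of_poly h / (1 - fps_X) ^ (polytope_dim P + 1)"
  shows "hstar_poly P = h"
  unfolding hstar_poly_def
proof (rule the_equality)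
  show "degree h \<le> polytope_dim P \<and>
    Abs_fps (\<lambda>t. real (ehrhart_count P t)) =
      fps_of_poly h / (1 - fps_X) ^ (polytope_dim P + 1)"
    using assms by blast
next
  fix g assume g: "degree g \<le> polytope_dim P \<and>
    Abs_fps (\<lambda>t. real (ehrhart_count P t)) =
      fps_of_poly g / (1 - fps_X) ^ (polytope_dim P + 1)"
  have "fps_of_poly g = fps_of_poly h"
  proof (rule fps_divide_right_cancel)
    show "fps_nth ((1 - fps_X :: real fps) ^ (polytope_dim P + 1)) 0 \<noteq> 0"
      by (simp only: fps_nth_power_0) simp
    show "fps_of_poly g / (1 - fps_X) ^ (polytope_dim P + 1) =
      fps_of_poly h / (1 - fps_X) ^ (polytope_dim P + 1)"
      using g assms(2) by metis
  qed
  then show "g = h"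
    by (simp add: fps_of_poly_eq_iff)
qed

end

theory Submission
  imports Defs
begin

text \<open>
  All four polytopes come from one two-parameter family of simplices. Inside the coordinate
  subspace spanned by a set \<open>I\<close> of \<open>d\<close> coordinates, with three distinguished ones \<open>p\<close>, \<open>q\<close>, \<open>a\<close>,
  let \<open>Delta\<close> be the simplex with vertices \<open>0\<close>, \<open>c e\<^sub>p\<close>, \<open>e\<^sub>p + e\<^sub>q + N e\<^sub>a\<close> and \<open>e\<^sub>j\<close> for all other
  \<open>j\<close> in \<open>I\<close>. For \<open>c = 1\<close> and \<open>d = 3\<close> this is Reeve's tetrahedron.

  Taking integer parts of barycentric coordinates writes every lattice point of the cone over
  \<open>Delta\<close> uniquely as a lattice point of the half-open fundamental parallelepiped plus a
  nonnegative integer combination of the vertices. The parallelepiped has \<open>c N\<close> lattice points: one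
  at height 0, \<open>c - 1\<close> at height 1 and \<open>c (N - 1)\<close> at height 2. Hence
  \[ h^*(z) = 1 + (c - 1) z + c (N - 1) z^2, \]
  or equivalently
  \[ i(t) = {t + d \choose d} + (c - 1) {t + d - 1 \choose d} + c (N - 1) {t + d - 2 \choose d} \]
  (\<open>ehrhart_count_Delta\<close>, \<open>hstar_poly_Delta\<close>). With \<open>c = 1\<close> and \<open>N \<ge> 2\<close> there is a gap
  between the coefficients of \<open>z^0\<close> and \<open>z^2\<close>, so unimodality fails; otherwise it holds
  (\<open>ehrhart_unimodal_Delta\<close>).

  The three binomials share the factor \<open>(t + 1) \<dots> (t + d - 2)\<close>, whose coefficients are positive, and
  what remains is a quadratic in \<open>t\<close> (\<open>ehrhart_poly_Delta\<close>). For \<open>c = 1\<close> and \<open>N \<le> 2\<close> the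
  quadratic has positive coefficients, hence so has the product. For fixed \<open>c\<close> its linear
  coefficient tends to \<open>-\<infinity>\<close> as \<open>N\<close> grows while its constant term stays fixed, so the linear
  coefficient of \<open>i\<close> eventually fails to be positive. Therefore \<open>(c, N)\<close> can be taken to be
  \<open>(1, 1)\<close>, \<open>(1, 2)\<close>, \<open>(2, large)\<close> and \<open>(1, large)\<close>, respectively.
\<close>

section \<open>Counting nonnegative integer vectors of bounded sum\<close>

definition bounded_sum_funs :: "'a set \<Rightarrow> nat \<Rightarrow> ('a \<Rightarrow> nat) set"
  where "bounded_sum_funs I s = {f. (\<forall>i. i \<notin> I \<longrightarrow> f i = 0) \<and> sum f I \<le> s}"

text \<open>
  Splitting off the value at one new index is the recursion behind the count below.
\<close>

lemma bounded_sum_funs_insert: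
  assumes "finite I" "i \<notin> I"
  shows "bij_betw (\<lambda>(j, f). f(i := j)) (SIGMA j:{..s}. bounded_sum_funs I (s - j))
           (bounded_sum_funs (insert i I) s)"
proof (rule bij_betw_byWitness[where f' = "\<lambda>g. (g i, g(i := 0))"])
  have same: "sum (g(i := j)) I = sum g I" for g :: "'a \<Rightarrow> nat" and j
    using assms(2) by (intro sum.cong) auto
  show "\<forall>x\<in>SIGMA j:{..s}. bounded_sum_funs I (s - j).
      (\<lambda>g. (g i, g(i := 0))) ((\<lambda>(j, f). f(i := j)) x) = x"
    using assms(2) by (auto simp: bounded_sum_funs_def fun_eq_iff)
  show "\<forall>g\<in>bounded_sum_funs (insert i I) s. (\<lambda>(j, f). f(i := j)) (g i, g(i := 0)) = g"
    by auto
  show "(\<lambda>(j, f). f(i := j)) ` (SIGMA j:{..s}. bounded_sum_funs I (s - j))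
      \<subseteq> bounded_sum_funs (insert i I) s"
    using assms same by (force simp: bounded_sum_funs_def)
  show "(\<lambda>g. (g i, g(i := 0))) ` bounded_sum_funs (insert i I) s
      \<subseteq> (SIGMA j:{..s}. bounded_sum_funs I (s - j))"
    using assms same by (auto simp: bounded_sum_funs_def)
qed

lemma card_bounded_sum_funs:
  assumes "finite I"
  shows "finite (bounded_sum_funs I s) \<and>
    card (bounded_sum_funs I s) = (s + card I) choose card I"
  using assms
proof (induction I arbitrary: s rule: finite_induct)
  case empty
  have "bounded_sum_funs ({} :: 'a set) s = {\<lambda>_. 0}"
    by (auto simp: bounded_sum_funs_def)
  then show ?case by simp
next
  case (insert i I)
  have fin: "finite (SIGMA j:{..s}. bounded_sum_funs I (s - j))"
    using insert.IH by auto
  have "card (bounded_sum_funs (insert i I) s) =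
      card (SIGMA j:{..s}. bounded_sum_funs I (s - j))"
    by (rule bij_betw_same_card[OF bounded_sum_funs_insert[OF insert.hyps(1,2)], symmetric])
  also have "\<dots> = (\<Sum>j\<le>s. (s - j + card I) choose card I)"
    using insert.IH by (subst card_SigmaI) auto
  also have "\<dots> = (\<Sum>j\<le>s. (card I + j) choose card I)"
    by (rule sum.reindex_bij_witness[where i = "\<lambda>j. s - j" and j = "\<lambda>j. s - j"])
      (auto simp: add.commute)
  also have "\<dots> = (s + card (insert i I)) choose card (insert i I)"
    using insert.hyps choose_rising_sum(1)[of "card I" s] by (simp add: add_ac)
  finally show ?case
    using bij_betw_finite[OF bounded_sum_funs_insert[OF insert.hyps(1,2)]] fin by blast
qed

text \<open>
  The bound \<open>h \<le> card I\<close> makes the formula correct for \<open>t < h\<close> too: the truncated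
  subtraction then does not occur, and the binomial coefficient vanishes.
\<close>

lemma card_bounded_sum_funs_shift:
  assumes "finite I" "h \<le> card I"
  shows "card {f. (\<forall>i. i \<notin> I \<longrightarrow> f i = 0) \<and> sum f I + h \<le> t} = (t + card I - h) choose card I"
proof (cases "h \<le> t")
  case True
  then have "{f. (\<forall>i. i \<notin> I \<longrightarrow> f i = 0) \<and> sum f I + h \<le> t} = bounded_sum_funs I (t - h)"
    by (auto simp: bounded_sum_funs_def)
  with True assms show ?thesis
    by (simp add: card_bounded_sum_funs)
next
  case False
  then have "{f. (\<forall>i. i \<notin> I \<longrightarrow> f i = 0) \<and> sum f I + h \<le> t} = {}"
    by auto
  moreover have "t + card I - h < card I"
    using False assms(2) by linarith
  ultimately show ?thesis
    by (metis binomial_eq_0 card.empty)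
qed

section \<open>Generating functions and polynomials with positive coefficients\<close>

lemma fps_shifted_choose:
  assumes "s \<le> d"
  shows "Abs_fps (\<lambda>t. real ((t + d - s) choose d)) = fps_X ^ s / (1 - fps_X) ^ (d + 1)"
proof -
  have unit: "fps_nth ((1 - fps_X :: real fps) ^ (d + 1)) 0 \<noteq> 0"
    by (simp only: fps_nth_power_0) simp
  have inv: "inverse ((1 - fps_X :: real fps) ^ (d + 1)) = Abs_fps (\<lambda>k. real ((d + k) choose k))"
    using one_minus_const_fps_X_neg_power'[of "d + 1" "1 :: real"] by simp
  have "real ((t + d - s) choose d) =
      (if t < s then 0 else real ((d + (t - s)) choose (t - s)))" for t
  proof (cases "t < s")
    case True
    then show ?thesis using assms by (simp add: binomial_eq_0)
  next
    case False
    then show ?thesis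
      using binomial_symmetric[of d "t + d - s"] by (simp add: add.commute)
  qed
  then show ?thesis
    unfolding fps_divide_unit[OF unit] inv by (simp add: fps_eq_iff fps_X_power_mult_nth)
qed

definition pos_coeffs :: "nat \<Rightarrow> real poly \<Rightarrow> bool"
  where "pos_coeffs n f \<longleftrightarrow> degree f \<le> n \<and> (\<forall>k\<le>n. coeff f k > 0)"

text \<open>
  All coefficients of both factors are nonnegative, so no cancellation occurs, and the coefficient of
  degree \<open>k\<close> contains the positive term with index \<open>min k m\<close>.
\<close>

lemma pos_coeffs_mult:
  assumes f: "pos_coeffs m f" and g: "pos_coeffs n g"
  shows "pos_coeffs (m + n) (f * g)"
  unfolding pos_coeffs_def
proof (intro conjI allI impI)
  show "degree (f * g) \<le> m + n"
    using f g degree_mult_le[of f g] by (auto simp: pos_coeffs_def)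
next
  fix k assume k: "k \<le> m + n"
  have nonneg: "0 \<le> coeff f i" "0 \<le> coeff g i" for i
    using f g by (metis pos_coeffs_def coeff_eq_0 le_less_linear less_eq_real_def order_le_less_trans)+
  have "0 < coeff f (min k m) * coeff g (k - min k m)"
    using f g k by (intro mult_pos_pos) (auto simp: pos_coeffs_def min_def)
  also have "\<dots> \<le> (\<Sum>i\<le>k. coeff f i * coeff g (k - i))"
    using nonneg by (intro member_le_sum) auto
  finally show "0 < coeff (f * g) k"
    by (simp add: coeff_mult)
qed

lemma pos_coeffs_pochhammer: "pos_coeffs n (pochhammer [:1, 1:] n)"
proof (induction n)
  case 0
  then show ?case by (simp add: pos_coeffs_def)
next
  case (Suc n)
  have "pos_coeffs 1 ([:1, 1:] + of_nat n)"
    by (auto simp: pos_coeffs_def of_nat_poly coeff_pCons split: nat.split)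
  then show ?case
    using pos_coeffs_mult[OF Suc.IH, of 1] by (simp add: pochhammer_Suc)
qed

lemma poly_pochhammer: "poly (pochhammer f n) x = pochhammer (poly f x) n"
  by (induction n) (simp_all add: pochhammer_Suc)

text \<open>
  For \<open>c, N \<ge> 1\<close> this is the quadratic
  \<open>(t + d - 1) (t + d) + (c - 1) t (t + d - 1) + c (N - 1) (t - 1) t\<close>,
  the cofactor of \<open>(t + 1) \<dots> (t + d - 2) / d!\<close> in the Ehrhart polynomial of the simplex below.
\<close>

definition ehrhart_factor :: "nat \<Rightarrow> nat \<Rightarrow> nat \<Rightarrow> real poly"
  where "ehrhart_factor d c N =
    [:real d * (real d - 1),
      2 * real d - 1 + real (c - 1) * (real d - 1) - real (c * (N - 1)),
      real (c * N):]"

text \<open>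
  The constant term of the quadratic does not depend on \<open>N\<close>, while its linear coefficient decreases
  without bound as \<open>N\<close> grows; it enters the linear coefficient of the product multiplied by the
  positive constant term of the other factor.
\<close>

lemma ehrhart_factor_linear_coeff_nonpos:
  assumes "c > 0"
  obtains N where "N \<ge> 2"
    "coeff (pochhammer [:1, 1:] (d - 2) * ehrhart_factor d c N) 1 \<le> 0"
proof -
  define Q :: "real poly" where "Q = pochhammer [:1, 1:] (d - 2)"
  define K where "K = 2 * real d - 1 + real (c - 1) * (real d - 1)"
  have Q0: "0 < coeff Q 0"
    using pos_coeffs_pochhammer[of "d - 2"] by (simp add: pos_coeffs_def Q_def)
  then obtain n where n: "coeff Q 0 * K + coeff Q 1 * (real d * (real d - 1)) < real n * coeff Q 0"
    using ex_less_of_nat_mult by blast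
  have "n \<le> c * (n + 1)"
    using assms by (metis le_add1 le_trans mult_le_mono1 nat_mult_1 Suc_leI One_nat_def)
  then have "real n \<le> real (c * (n + 1))"
    by (rule of_nat_mono)
  then have "real n * coeff Q 0 \<le> real (c * (n + 1)) * coeff Q 0"
    using Q0 by (intro mult_right_mono) auto
  moreover have "coeff (Q * ehrhart_factor d c (n + 2)) 1 =
      coeff Q 0 * K + coeff Q 1 * (real d * (real d - 1)) - real (c * (n + 1)) * coeff Q 0"
    by (simp add: coeff_mult ehrhart_factor_def K_def algebra_simps)
  ultimately show thesis
    using n by (intro that[of "n + 2"]) (auto simp: Q_def)
qed

section \<open>The simplices and their barycentric coordinates\<close>

locale reeve_simplex =
  fixes I :: "'n::finite set" and p q a :: 'n and c N :: nat
  assumes in_I: "p \<in> I" "q \<in> I" "a \<in> I"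
    and distinct: "p \<noteq> q" "p \<noteq> a" "q \<noteq> a"
    and pos: "c > 0" "N > 0"
begin

definition vertex :: "'n \<Rightarrow> real ^ 'n"
  where "vertex j =
    (if j = p then axis p (real c)
     else if j = a then axis p 1 + axis q 1 + axis a (real N)
     else axis j 1)"

definition Delta :: "(real ^ 'n) set"
  where "Delta = convex hull (insert 0 (vertex ` I))"

text \<open>
  The coefficient of \<open>vertex j\<close> when \<open>x\<close> is written as a combination of the vertices other than the
  origin: \<open>bary_decomposition\<close> and \<open>bary_vertex\<close>.
\<close>

definition bary :: "real ^ 'n \<Rightarrow> 'n \<Rightarrow> real"
  where "bary x j =
    (if j = a then x $ a / real N
     else if j = q then x $ q - x $ a / real N
     else if j = p then (x $ p - x $ a / real N) / real c
     else x $ j)"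

definition region :: "real \<Rightarrow> (real ^ 'n) set"
  where "region t = {x. (\<forall>j. j \<notin> I \<longrightarrow> x $ j = 0) \<and> (\<forall>j\<in>I. 0 \<le> bary x j) \<and>
    (\<Sum>j\<in>I. bary x j) \<le> t}"

lemma sum_split_I:
  "sum g I = g p + g q + g a + sum g (I - {p, q, a})" for g :: "'n \<Rightarrow> 'b::comm_monoid_add"
proof -
  have "I = insert p (insert q (insert a (I - {p, q, a})))"
    using in_I by auto
  then have "sum g I = sum g (insert p (insert q (insert a (I - {p, q, a}))))"
    by simp
  also have "\<dots> = g p + g q + g a + sum g (I - {p, q, a})"
    using distinct by (simp add: add.assoc)
  finally show ?thesis .
qed

lemma card_I_ge_3: "3 \<le> card I"
proof -
  have "card {p, q, a} \<le> card I"
    using in_I by (intro card_mono) auto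
  then show ?thesis
    using distinct by simp
qed

lemma lattice_polytope_Delta: "lattice_polytope Delta"
  unfolding lattice_polytope_def Delta_def
proof (intro exI conjI)
  show "insert 0 (vertex ` I) \<subseteq> integer_points"
    by (auto simp: integer_points_def vertex_def axis_def)
qed auto

lemma bary_lincomb: "bary (u *\<^sub>R x + v *\<^sub>R y) j = u * bary x j + v * bary y j"
  by (simp add: bary_def add_divide_distrib diff_divide_distrib algebra_simps)

lemma bary_scaleR: "bary (u *\<^sub>R x) j = u * bary x j"
  using bary_lincomb[of u x 0 x j] by simp

lemma scaleR_in_region:
  assumes "x \<in> region t" "0 \<le> u"
  shows "u *\<^sub>R x \<in> region (u * t)"
proof -
  have "(\<Sum>j\<in>I. bary (u *\<^sub>R x) j) = u * (\<Sum>j\<in>I. bary x j)"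
    by (simp add: bary_scaleR sum_distrib_left)
  with assms show ?thesis
    by (simp add: region_def bary_scaleR mult_left_mono)
qed

lemma bary_vertex:
  assumes "i \<in> I"
  shows "bary (vertex i) j = (if j = i then 1 else 0)"
  using assms distinct pos by (auto simp: bary_def vertex_def axis_def)

lemma bary_decomposition:
  assumes "\<And>j. j \<notin> I \<Longrightarrow> x $ j = 0"
  shows "(\<Sum>j\<in>I. bary x j *\<^sub>R vertex j) = x"
proof -
  have rest: "(\<Sum>j\<in>I - {p, q, a}. (bary x j *\<^sub>R vertex j) $ i) =
      (if i \<in> I - {p, q, a} then x $ i else 0)" for i
  proof -
    have "(\<Sum>j\<in>I - {p, q, a}. (bary x j *\<^sub>R vertex j) $ i) =
        (\<Sum>j\<in>I - {p, q, a}. if j = i then x $ i else 0)"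
      by (intro sum.cong) (auto simp: bary_def vertex_def axis_def)
    then show ?thesis by simp
  qed
  have "(\<Sum>j\<in>I. (bary x j *\<^sub>R vertex j) $ i) = x $ i" for i
    unfolding sum_split_I rest
    using assms[of i] in_I distinct pos
    by (auto simp: bary_def vertex_def axis_def)
  then show ?thesis by (simp add: vec_eq_iff)
qed

lemma convex_region: "convex (region t)"
proof (rule convexI)
  fix x y :: "real ^ 'n" and u v :: real
  assume x: "x \<in> region t" and y: "y \<in> region t" and uv: "0 \<le> u" "0 \<le> v" "u + v = 1"
  have "(\<Sum>j\<in>I. bary (u *\<^sub>R x + v *\<^sub>R y) j) = u * (\<Sum>j\<in>I. bary x j) + v * (\<Sum>j\<in>I. bary y j)"
    by (simp add: bary_lincomb sum.distrib sum_distrib_left)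
  also have "\<dots> \<le> t"
    using x y uv by (intro convex_bound_le) (auto simp: region_def)
  finally show "u *\<^sub>R x + v *\<^sub>R y \<in> region t"
    using x y uv by (auto simp: region_def bary_lincomb)
qed

text \<open>
  The origin receives whatever weight the barycentric coordinates leave over.
\<close>

lemma Delta_eq_region: "Delta = region 1"
proof
  have "insert 0 (vertex ` I) \<subseteq> region 1"
    using in_I bary_scaleR[of 0 0]
    by (auto simp: region_def bary_vertex) (auto simp: vertex_def axis_def)
  then show "Delta \<subseteq> region 1"
    unfolding Delta_def by (rule hull_minimal) (rule convex_region)
next
  show "region 1 \<subseteq> Delta"
  proof
    fix x assume x: "x \<in> region 1"
    \<comment> \<open>\<open>None\<close> stands for the vertex at the origin.\<close>
    define w where "w = (\<lambda>j. case j of None \<Rightarrow> 1 - (\<Sum>j\<in>I. bary x j) | Some j \<Rightarrow> bary x j)"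
    define v where "v = (\<lambda>j. case j of None \<Rightarrow> 0 | Some j \<Rightarrow> vertex j)"
    have split: "sum g (insert None (Some ` I)) = g None + (\<Sum>j\<in>I. g (Some j))"
      for g :: "'n option \<Rightarrow> 'b::comm_monoid_add"
      by (subst sum.insert) (auto simp: sum.reindex)
    have "(\<Sum>j\<in>insert None (Some ` I). w j *\<^sub>R v j) \<in> Delta"
    proof (rule convex_sum)
      show "convex Delta" by (simp add: Delta_def)
      show "sum w (insert None (Some ` I)) = 1"
        unfolding split by (simp add: w_def)
      show "0 \<le> w j" if "j \<in> insert None (Some ` I)" for j
        using that x by (auto simp: w_def region_def)
      show "v j \<in> Delta" if "j \<in> insert None (Some ` I)" for j
        using that by (auto simp: v_def Delta_def intro: hull_inc)
    qed simp
    then show "x \<in> Delta"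
      using x bary_decomposition[of x] unfolding split by (simp add: w_def v_def region_def)
  qed
qed

lemma dilate_Delta: "(\<lambda>x. real t *\<^sub>R x) ` Delta = region (real t)"
proof
  show "(\<lambda>x. real t *\<^sub>R x) ` Delta \<subseteq> region (real t)"
    unfolding Delta_eq_region
    using scaleR_in_region[of _ 1 "real t"] by auto
next
  show "region (real t) \<subseteq> (\<lambda>x. real t *\<^sub>R x) ` Delta"
  proof (cases "t = 0")
    \<comment> \<open>Rescaling by \<open>1 / t\<close> is impossible here, but only the origin has to be considered.\<close>
    case True
    have "x = 0" if x: "x \<in> region 0" for x
    proof -
      have nonneg: "\<forall>j\<in>I. 0 \<le> bary x j" and "sum (bary x) I \<le> 0"
        using x by (simp_all add: region_def)
      then have "sum (bary x) I = 0"
        by (meson antisym sum_nonneg)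
      then have "\<forall>j\<in>I. bary x j = 0"
        using nonneg by (subst (asm) sum_nonneg_eq_0_iff) auto
      then show ?thesis
        using x bary_decomposition[of x] by (simp add: region_def)
    qed
    moreover have "0 \<in> Delta" by (simp add: Delta_def hull_inc)
    ultimately show ?thesis using True by auto
  next
    case False
    show ?thesis
    proof
      fix x assume x: "x \<in> region (real t)"
      have "(1 / real t) *\<^sub>R x \<in> region 1"
        using scaleR_in_region[OF x, of "1 / real t"] False by simp
      then show "x \<in> (\<lambda>x. real t *\<^sub>R x) ` Delta"
        unfolding Delta_eq_region
        by (rule rev_image_eqI) (use False in simp)
    qed
  qed
qed

lemma aff_dim_Delta: "aff_dim Delta = int (card I)"
proof -
  have "span (insert 0 (vertex ` I)) = {x. \<forall>j. j \<notin> I \<longrightarrow> x $ j = 0}" (is "_ = ?W")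
  proof
    show "span (insert 0 (vertex ` I)) \<subseteq> ?W"
    proof (rule span_minimal)
      show "insert 0 (vertex ` I) \<subseteq> ?W"
        using in_I by (auto simp: vertex_def axis_def)
      show "subspace ?W" by (auto simp: subspace_def)
    qed
    show "?W \<subseteq> span (insert 0 (vertex ` I))"
    proof
      fix x assume "x \<in> ?W"
      then have "x = (\<Sum>j\<in>I. bary x j *\<^sub>R vertex j)"
        by (simp add: bary_decomposition)
      also have "\<dots> \<in> span (insert 0 (vertex ` I))"
        by (intro span_sum span_scale span_base) auto
      finally show "x \<in> span (insert 0 (vertex ` I))" .
    qed
  qed
  then have "dim (insert 0 (vertex ` I)) = dim ?W"
    by (metis dim_span)
  also have "\<dots> = card I"
    using dim_substandard_cart[where 'a = real and d = I] by (simp add: dim_vec_eq)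
  finally show ?thesis
    by (simp add: Delta_def aff_dim_convex_hull aff_dim_zero hull_inc)
qed

section \<open>Lattice points in dilates of the simplex\<close>

text \<open>
  The lattice points of the fundamental parallelepiped are indexed by \<open>k < c\<close> and \<open>r < N\<close>, where
  \<open>r\<close> is the coordinate in direction \<open>a\<close>. The barycentric coordinates at \<open>a\<close> and \<open>q\<close> are the
  fractional parts of \<open>r / N\<close> and \<open>- r / N\<close>; the term \<open>carry r\<close> rounds \<open>r / N\<close> up. The coordinate
  at \<open>p\<close> is one of the \<open>c\<close> numbers in \<open>[0, 1)\<close> whose \<open>c\<close>-fold is congruent to \<open>- r / N\<close> modulo 1.
\<close>

definition carry :: "nat \<Rightarrow> nat"
  where "carry r = (if r = 0 then 0 else 1)"

definition box_coord :: "nat \<Rightarrow> nat \<Rightarrow> 'n \<Rightarrow> real"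
  where "box_coord k r j =
    (if j = a then real r / real N
     else if j = q then real (carry r) - real r / real N
     else if j = p then (real k + real (carry r) - real r / real N) / real c
     else 0)"

text \<open>
  The height of a parallelepiped point is the smallest integer dilation factor for which the dilate of
  \<open>Delta\<close> contains it, that is, the sum of its barycentric coordinates rounded up
  (\<open>sum_box_coord\<close>).
\<close>

definition height :: "nat \<Rightarrow> nat \<Rightarrow> nat"
  where "height k r = (if r = 0 then if k = 0 then 0 else 1 else 2)"

text \<open>
  The sum of the parallelepiped point \<open>(k, r)\<close> and the combination of the vertices with
  coefficients \<open>f\<close>, in Cartesian coordinates.
\<close>

definition point :: "nat \<Rightarrow> nat \<Rightarrow> ('n \<Rightarrow> nat) \<Rightarrow> real ^ 'n"
  where "point k r f = (\<chi> j. real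
    (if j = a then N * f a + r
     else if j = q then f q + f a + carry r
     else if j = p then c * f p + k + f a + carry r
     else f j))"

definition layer :: "nat \<Rightarrow> nat \<Rightarrow> nat \<Rightarrow> ('n \<Rightarrow> nat) set"
  where "layer t k r = {f. (\<forall>j. j \<notin> I \<longrightarrow> f j = 0) \<and> sum f I + height k r \<le> t}"

lemma bary_point: "bary (point k r f) j = real (f j) + box_coord k r j"
  using distinct pos by (auto simp: bary_def point_def box_coord_def field_simps)

lemma box_coord_bounds:
  assumes "k < c" "r < N"
  shows "0 \<le> box_coord k r j" "box_coord k r j < 1"
proof -
  have frac: "real r / real N \<ge> 0" "real r / real N < 1"
    and frac_pos: "r > 0 \<Longrightarrow> real r / real N > 0"
    using assms(2) by auto
  have "real k + 1 \<le> real c"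
    using assms(1) by linarith
  moreover have "0 \<le> real k + real (carry r) - real r / real N"
    "real k + real (carry r) - real r / real N < real k + 1"
    using frac frac_pos by (auto simp: carry_def)
  ultimately show "0 \<le> box_coord k r j" "box_coord k r j < 1"
    using frac frac_pos pos by (auto simp: box_coord_def carry_def)
qed

text \<open>
  The coordinates at \<open>a\<close> and \<open>q\<close> are complementary fractions, so they add up to \<open>carry r\<close>, and only
  the coordinate at \<open>p\<close> remains. It lies in \<open>[0, 1)\<close> and vanishes only for \<open>k = r = 0\<close>.
\<close>

lemma sum_box_coord:
  assumes "k < c" "r < N"
  shows "real (height k r) - 1 < (\<Sum>j\<in>I. box_coord k r j)"
    "(\<Sum>j\<in>I. box_coord k r j) \<le> real (height k r)"
proof -
  have "(\<Sum>j\<in>I - {p, q, a}. box_coord k r j) = 0"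
    by (intro sum.neutral) (auto simp: box_coord_def)
  then have total: "(\<Sum>j\<in>I. box_coord k r j) = box_coord k r p + real (carry r)"
    using distinct by (simp add: sum_split_I) (simp add: box_coord_def)
  have pos_p: "0 < box_coord k r p" if "k > 0 \<or> r > 0"
  proof -
    have "real r / real N < 1" using assms(2) by simp
    then have "0 < real k + real (carry r) - real r / real N"
      using that by (auto simp: carry_def)
    then show ?thesis
      using pos distinct by (simp add: box_coord_def)
  qed
  have zero_p: "box_coord 0 0 p = 0"
    using distinct by (simp add: box_coord_def carry_def)
  show "real (height k r) - 1 < (\<Sum>j\<in>I. box_coord k r j)"
    "(\<Sum>j\<in>I. box_coord k r j) \<le> real (height k r)"
    unfolding total using pos_p zero_p box_coord_bounds[OF assms, of p]
    by (auto simp: height_def carry_def)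
qed

lemma point_in_region_iff:
  assumes "k < c" "r < N" and supp: "\<And>j. j \<notin> I \<Longrightarrow> f j = 0"
  shows "point k r f \<in> region (real t) \<longleftrightarrow> sum f I + height k r \<le> t"
proof -
  have total: "(\<Sum>j\<in>I. bary (point k r f) j) = real (sum f I) + (\<Sum>j\<in>I. box_coord k r j)"
    by (simp add: bary_point sum.distrib)
  have "point k r f $ j = 0" if "j \<notin> I" for j
    using that supp[OF that] in_I by (auto simp: point_def)
  moreover have "0 \<le> bary (point k r f) j" for j
    using box_coord_bounds(1)[OF assms(1,2)] by (simp add: bary_point)
  ultimately have "point k r f \<in> region (real t) \<longleftrightarrow>
      real (sum f I) + (\<Sum>j\<in>I. box_coord k r j) \<le> real t"
    by (simp add: region_def total del: of_nat_sum)
  also have "\<dots> \<longleftrightarrow> sum f I + height k r \<le> t"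
    using sum_box_coord[OF assms(1,2)] by linarith
  finally show ?thesis .
qed

text \<open>
  The vector \<open>f\<close> consists of the integer parts of the barycentric coordinates; the fractional parts
  at \<open>a\<close> and \<open>p\<close> give back \<open>r\<close> and \<open>k\<close>.
\<close>

lemma point_inject:
  assumes "k < c" "r < N" "k' < c" "r' < N" "point k r f = point k' r' f'"
  shows "k = k' \<and> r = r' \<and> f = f'"
proof -
  have eq: "real (f j) + box_coord k r j = real (f' j) + box_coord k' r' j" for j
    using assms(5) by (metis bary_point)
  have f: "f j = f' j" for j
    using eq[of j] box_coord_bounds[OF assms(1,2), of j] box_coord_bounds[OF assms(3,4), of j]
    by linarith
  then have box: "box_coord k r j = box_coord k' r' j" for j
    using eq[of j] by simp
  have r: "r = r'"
    using box[of a] pos by (simp add: box_coord_def)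
  have "k = k'"
    using box[of p] pos distinct r by (simp add: box_coord_def)
  with f r show ?thesis by auto
qed

text \<open>
  Division with remainder by \<open>N\<close> of the coordinate at \<open>a\<close>, and then by \<open>c\<close> of what is left at \<open>p\<close>,
  recovers the decomposition. That nothing becomes negative rests on the integrality of \<open>x\<close>: from
  \<open>x\<^sub>q \<ge> x\<^sub>a / N\<close> it follows that \<open>x\<^sub>q\<close> is at least \<open>x\<^sub>a / N\<close> rounded up, and likewise for \<open>x\<^sub>p\<close>.
\<close>

lemma point_surj:
  assumes int: "x \<in> integer_points" and x: "x \<in> region t"
  obtains k r f where "k < c" "r < N" "\<And>j. j \<notin> I \<Longrightarrow> f j = 0" "x = point k r f"
proof -
  have bary: "0 \<le> bary x j" if "j \<in> I" for j
    using x that by (simp add: region_def)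
  have supp: "x $ j = 0" if "j \<notin> I" for j
    using x that by (simp add: region_def)
  have a: "0 \<le> x $ a / real N"
    using bary[OF in_I(3)] by (simp add: bary_def)
  have q: "x $ a / real N \<le> x $ q"
    using bary[OF in_I(2)] distinct by (simp add: bary_def)
  have p: "x $ a / real N \<le> x $ p"
    using bary[OF in_I(1)] distinct pos by (simp add: bary_def zero_le_divide_iff)
  have "0 \<le> x $ j" for j
  proof (cases "j \<in> {p, q, a} \<or> j \<notin> I")
    case True
    moreover have "0 \<le> x $ a" using a pos by (simp add: zero_le_divide_iff)
    ultimately show ?thesis using order_trans[OF a p] order_trans[OF a q] supp by auto
  next
    case False
    then show ?thesis using bary[of j] by (auto simp: bary_def)
  qed
  moreover have "x $ j \<in> \<int>" for j
    using int by (simp add: integer_points_def)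
  ultimately have "\<exists>m. x $ j = real m" for j
    by (metis Ints_cases of_int_0_le_iff of_int_of_nat_eq zero_le_imp_eq_int)
  then obtain n where n: "\<And>j. x $ j = real (n j)"
    by metis
  define A where "A = n a div N"
  define r where "r = n a mod N"
  have na: "n a = N * A + r" and r: "r < N"
    using pos by (simp_all add: A_def r_def)
  have ge: "A + carry r \<le> m" if "x $ a / real N \<le> real m" for m
  proof -
    have "real (N * A + r) \<le> real (N * m)"
      using that pos by (simp add: n na field_simps)
    then have le: "N * A + r \<le> N * m"
      using of_nat_le_iff by blast
    show ?thesis
    proof (cases "r = 0")
      case True
      then show ?thesis using le pos by (simp add: carry_def)
    next
      case False
      then have "N * A < N * m" using le by linarith
      then show ?thesis using False by (simp add: carry_def)
    qed
  qed
  have nq: "A + carry r \<le> n q" and np: "A + carry r \<le> n p"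
    using ge p q n by auto
  define y where "y = n p - A - carry r"
  define f where "f = (\<lambda>j. if j = a then A else if j = q then n q - A - carry r
    else if j = p then y div c else n j)"
  have "x $ j = point (y mod c) r f $ j" for j
  proof -
    have "c * (y div c) + y mod c + A + carry r = n p"
      using np unfolding y_def by simp
    then show ?thesis
      using nq na distinct unfolding n by (auto simp: point_def f_def)
  qed
  then have "x = point (y mod c) r f"
    by (simp add: vec_eq_iff)
  moreover have "f j = 0" if "j \<notin> I" for j
    using that supp[OF that] in_I n[of j] by (auto simp: f_def)
  ultimately show thesis
    using that[of "y mod c" r f] r pos by auto
qed

lemma bij_betw_point:
  "bij_betw (\<lambda>((k, r), f). point k r f)
     (SIGMA (k, r):{..<c} \<times> {..<N}. layer t k r) (region (real t) \<inter> integer_points)"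
  unfolding bij_betw_def
proof
  show "inj_on (\<lambda>((k, r), f). point k r f) (SIGMA (k, r):{..<c} \<times> {..<N}. layer t k r)"
    by (rule inj_onI) (clarsimp, blast dest: point_inject)
  show "(\<lambda>((k, r), f). point k r f) ` (SIGMA (k, r):{..<c} \<times> {..<N}. layer t k r) =
      region (real t) \<inter> integer_points" (is "?L = ?R")
  proof
    show "?L \<subseteq> ?R"
      by (auto simp: layer_def point_in_region_iff) (simp add: integer_points_def point_def)
    show "?R \<subseteq> ?L"
    proof
      fix x assume x: "x \<in> ?R"
      then obtain k r f where krf: "k < c" "r < N" "\<And>j. j \<notin> I \<Longrightarrow> f j = 0" "x = point k r f"
        using point_surj[of x "real t"] by auto
      then have "f \<in> layer t k r"
        using x by (auto simp: layer_def point_in_region_iff)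
      with krf show "x \<in> ?L" by (intro image_eqI[of _ _ "((k, r), f)"]) auto
    qed
  qed
qed

lemma sum_height:
  fixes g :: "nat \<Rightarrow> nat"
  shows "(\<Sum>(k, r)\<in>{..<c} \<times> {..<N}. g (height k r)) = g 0 + (c - 1) * g 1 + c * (N - 1) * g 2"
proof -
  have split: "{..<m} = insert 0 {1..<m}" if "m > 0" for m :: nat
    using that by auto
  have inner: "(\<Sum>r<N. g (height k r)) = g (if k = 0 then 0 else 1) + (N - 1) * g 2" for k
    unfolding split[OF pos(2)] by (simp add: height_def)
  have "(\<Sum>k<c. g (if k = 0 then 0 else 1)) = g 0 + (c - 1) * g 1"
    unfolding split[OF pos(1)] by simp
  then show ?thesis
    by (simp add: sum.cartesian_product[symmetric] inner sum.distrib)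
qed

lemma ehrhart_count_Delta:
  "ehrhart_count Delta t = ((t + card I) choose card I)
     + (c - 1) * ((t + card I - 1) choose card I)
     + c * (N - 1) * ((t + card I - 2) choose card I)"
proof -
  have card_layer: "card (layer t k r) = (t + card I - height k r) choose card I" for k r
    unfolding layer_def using card_I_ge_3
    by (intro card_bounded_sum_funs_shift) (auto simp: height_def)
  have "layer t k r \<subseteq> bounded_sum_funs I t" for k r
    by (auto simp: layer_def bounded_sum_funs_def)
  then have "finite (layer t k r)" for k r
    using card_bounded_sum_funs[of I t] by (metis finite finite_subset)
  then have "card (SIGMA (k, r):{..<c} \<times> {..<N}. layer t k r) =
      (\<Sum>(k, r)\<in>{..<c} \<times> {..<N}. (t + card I - height k r) choose card I)"
    by (subst card_SigmaI) (auto simp: card_layer intro!: sum.cong)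
  then show ?thesis
    using bij_betw_same_card[OF bij_betw_point[of t]]
      sum_height[of "\<lambda>h. (t + card I - h) choose card I"]
    by (simp add: ehrhart_count_def dilate_Delta)
qed

section \<open>The Ehrhart and $h^*$-polynomials of the simplex\<close>

lemma polytope_dim_Delta: "polytope_dim Delta = card I"
  by (simp add: polytope_dim_def aff_dim_Delta)

lemma hstar_poly_Delta: "hstar_poly Delta = [:1, real (c - 1), real (c * (N - 1)):]"
proof (rule hstar_poly_eqI, unfold polytope_dim_Delta)
  let ?h = "[:1, real (c - 1), real (c * (N - 1)):]"
  let ?D = "(1 - fps_X :: real fps) ^ (card I + 1)"
  show "degree ?h \<le> card I"
    using card_I_ge_3 degree_pCons_le[of 1 "[:real (c - 1), real (c * (N - 1)):]"]
      degree_pCons_le[of "real (c - 1)" "[:real (c * (N - 1)):]"]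
    by simp
  have unit: "fps_nth ?D 0 \<noteq> 0"
    by (simp only: fps_nth_power_0) simp
  have "Abs_fps (\<lambda>t. real (ehrhart_count Delta t)) =
      Abs_fps (\<lambda>t. real ((t + card I - 0) choose card I))
      + fps_const (real (c - 1)) * Abs_fps (\<lambda>t. real ((t + card I - 1) choose card I))
      + fps_const (real (c * (N - 1))) * Abs_fps (\<lambda>t. real ((t + card I - 2) choose card I))"
    by (simp add: fps_eq_iff ehrhart_count_Delta)
  also have "\<dots> = fps_X ^ 0 / ?D + fps_const (real (c - 1)) * (fps_X ^ 1 / ?D)
      + fps_const (real (c * (N - 1))) * (fps_X ^ 2 / ?D)"
    using card_I_ge_3 by (simp only: fps_shifted_choose)
  also have "\<dots> = fps_of_poly ?h / ?D"
    unfolding fps_divide_unit[OF unit]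
    by (simp add: fps_of_poly_pCons algebra_simps power2_eq_square)
  finally show "Abs_fps (\<lambda>t. real (ehrhart_count Delta t)) = fps_of_poly ?h / ?D" .
qed

lemma ehrhart_unimodal_Delta: "ehrhart_unimodal Delta \<longleftrightarrow> c \<noteq> 1 \<or> N = 1"
proof
  assume "ehrhart_unimodal Delta"
  then obtain m where
    up: "\<And>j. j < m \<Longrightarrow> coeff (hstar_poly Delta) j \<le> coeff (hstar_poly Delta) (j + 1)" and
    down: "\<And>j. m \<le> j \<Longrightarrow> j < card I \<Longrightarrow>
      coeff (hstar_poly Delta) (j + 1) \<le> coeff (hstar_poly Delta) j"
    by (auto simp: ehrhart_unimodal_def polytope_dim_Delta)
  show "c \<noteq> 1 \<or> N = 1"
  proof (rule ccontr)
    assume "\<not> (c \<noteq> 1 \<or> N = 1)"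
    then have "c = 1" "N \<ge> 2" using pos by auto
    then show False
      using up[of 0] down[of 1] card_I_ge_3 unfolding hstar_poly_Delta
      by (cases "m = 0") (auto simp: numeral_2_eq_2)
  qed
next
  assume "c \<noteq> 1 \<or> N = 1"
  then consider "c = 1" "N = 1" | "c \<ge> 2" "N = 1" | "c \<ge> 2" "N \<ge> 2"
    using pos by linarith
  then show "ehrhart_unimodal Delta"
  proof cases
    case 1
    then show ?thesis
      unfolding ehrhart_unimodal_def polytope_dim_Delta hstar_poly_Delta
      by (intro exI[of _ 0]) (auto simp: coeff_pCons split: nat.split)
  next
    case 2
    then show ?thesis
      using card_I_ge_3
      unfolding ehrhart_unimodal_def polytope_dim_Delta hstar_poly_Delta
      by (intro exI[of _ 1]) (auto simp: coeff_pCons split: nat.split)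
  next
    case 3
    have "c - 1 \<le> c * (N - 1)"
      using 3 by (metis diff_le_self le_trans mult.right_neutral mult_le_mono2 One_nat_def
        Suc_1 Suc_le_eq zero_less_diff)
    then have "real (c - 1) \<le> real (c * (N - 1))"
      by (rule of_nat_mono)
    then show ?thesis
      using 3 card_I_ge_3
      unfolding ehrhart_unimodal_def polytope_dim_Delta hstar_poly_Delta
      by (intro exI[of _ 2]) (auto simp: coeff_pCons split: nat.split)
  qed
qed

text \<open>
  Each of the three binomial coefficients in \<open>ehrhart_count_Delta\<close> is a rising factorial with \<open>d\<close>
  factors, starting at \<open>t + 1\<close>, \<open>t\<close> and \<open>t - 1\<close>; the factors \<open>t + 1, \<dots>, t + d - 2\<close> are common to
  all of them.
\<close>

lemma ehrhart_poly_Delta: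
  "ehrhart_poly Delta =
    smult (1 / fact (card I)) (pochhammer [:1, 1:] (card I - 2) * ehrhart_factor (card I) c N)"
proof (rule ehrhart_poly_eqI)
  fix t
  obtain m where m: "card I = m + 2"
    using card_I_ge_3 by (metis add.commute le_Suc_ex numeral_2_eq_2 numeral_3_eq_3 Suc_leD)
  have shifted: "real ((t + card I - s) choose card I) =
      pochhammer (real t + 1 - real s) (card I) / fact (card I)" if "s \<le> 2" for s
    using that m by (simp add: binomial_gbinomial gbinomial_pochhammer' of_nat_diff algebra_simps)
  have p0: "pochhammer (real t + 1) (card I) =
      pochhammer (real t + 1) m * ((real t + 1 + m) * (real t + 2 + m))"
    by (simp add: m pochhammer_Suc algebra_simps)
  have p1: "pochhammer (real t) (card I) =
      pochhammer (real t + 1) m * (real t * (real t + 1 + m))"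
    using pochhammer_rec[of "real t" "Suc m"] pochhammer_Suc[of "real t + 1" m]
    by (simp add: m algebra_simps)
  have p2: "pochhammer (real t - 1) (card I) =
      pochhammer (real t + 1) m * ((real t - 1) * real t)"
    by (simp add: m pochhammer_rec)
  have "real (ehrhart_count Delta t) =
      (pochhammer (real t + 1) (card I) + real (c - 1) * pochhammer (real t) (card I)
        + real (c * (N - 1)) * pochhammer (real t - 1) (card I)) / fact (card I)"
    using shifted[of 0] shifted[of 1] shifted[of 2]
    by (simp add: ehrhart_count_Delta add_divide_distrib)
  also have "\<dots> = pochhammer (real t + 1) m * poly (ehrhart_factor (card I) c N) (real t) / fact (card I)"
    using pos unfolding p0 p1 p2 ehrhart_factor_def
    by (simp add: m of_nat_diff algebra_simps)
  finally show "poly (smult (1 / fact (card I))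
      (pochhammer [:1, 1:] (card I - 2) * ehrhart_factor (card I) c N)) (real t) =
      real (ehrhart_count Delta t)"
    by (simp add: m poly_pochhammer add.commute)
qed

lemma ehrhart_positive_Delta_small:
  assumes "c = 1" "N \<le> 2"
  shows "ehrhart_positive Delta"
proof -
  have "N = 1 \<or> N = 2" using assms(2) pos by auto
  then have "pos_coeffs 2 (ehrhart_factor (card I) c N)"
    using card_I_ge_3 assms(1)
    by (auto simp: pos_coeffs_def ehrhart_factor_def coeff_pCons split: nat.split)
  then have "pos_coeffs (card I - 2 + 2) (pochhammer [:1, 1:] (card I - 2) * ehrhart_factor (card I) c N)"
    by (intro pos_coeffs_mult pos_coeffs_pochhammer)
  then show ?thesis
    using card_I_ge_3
    by (simp add: ehrhart_positive_def polytope_dim_Delta ehrhart_poly_Delta pos_coeffs_def)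
qed

lemma not_ehrhart_positive_Delta:
  assumes "coeff (pochhammer [:1, 1:] (card I - 2) * ehrhart_factor (card I) c N) 1 \<le> 0"
  shows "\<not> ehrhart_positive Delta"
proof
  assume "ehrhart_positive Delta"
  then have "0 < coeff (ehrhart_poly Delta) 1"
    using card_I_ge_3 by (simp add: ehrhart_positive_def polytope_dim_Delta)
  then show False
    using assms by (simp add: ehrhart_poly_Delta zero_less_divide_iff)
qed

end

section \<open>The four combinations\<close>

theorem mainTheorem1:
  fixes d :: nat
  assumes "d \<ge> 3" and "d \<le> CARD('n::finite)"
  shows "\<exists>P\<^sub>1 P\<^sub>2 P\<^sub>3 P\<^sub>4 :: (real ^ 'n) set.
    (\<forall>P \<in> {P\<^sub>1, P\<^sub>2, P\<^sub>3, P\<^sub>4}. lattice_polytope P \<and> aff_dim P = int d) \<and>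
    (ehrhart_positive P\<^sub>1 \<and> ehrhart_unimodal P\<^sub>1) \<and>
    (ehrhart_positive P\<^sub>2 \<and> \<not> ehrhart_unimodal P\<^sub>2) \<and>
    (ehrhart_unimodal P\<^sub>3 \<and> \<not> ehrhart_positive P\<^sub>3) \<and>
    (\<not> ehrhart_positive P\<^sub>4 \<and> \<not> ehrhart_unimodal P\<^sub>4)"
proof -
  obtain I :: "'n set" where I: "card I = d"
    using obtain_subset_with_card_n[OF assms(2)] by auto
  then obtain T where "T \<subseteq> I" "card T = 3"
    using obtain_subset_with_card_n[of 3 I] assms(1) by auto
  then obtain p q a where in_I: "p \<in> I" "q \<in> I" "a \<in> I"
    and distinct: "p \<noteq> q" "p \<noteq> a" "q \<noteq> a"
    by (auto simp: card_3_iff)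
  obtain N3 where N3: "N3 \<ge> 2"
    "coeff (pochhammer [:1, 1:] (d - 2) * ehrhart_factor d 2 N3) 1 \<le> 0"
    by (rule ehrhart_factor_linear_coeff_nonpos[of 2]) auto
  obtain N4 where N4: "N4 \<ge> 2"
    "coeff (pochhammer [:1, 1:] (d - 2) * ehrhart_factor d 1 N4) 1 \<le> 0"
    by (rule ehrhart_factor_linear_coeff_nonpos[of 1]) auto
  interpret P1: reeve_simplex I p q a 1 1
    using in_I distinct by unfold_locales auto
  interpret P2: reeve_simplex I p q a 1 2
    using in_I distinct by unfold_locales auto
  interpret P3: reeve_simplex I p q a 2 N3
    using in_I distinct N3(1) by unfold_locales auto
  interpret P4: reeve_simplex I p q a 1 N4
    using in_I distinct N4(1) by unfold_locales auto
  show ?thesis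
  proof (intro exI conjI)
    show "\<forall>P \<in> {P1.Delta, P2.Delta, P3.Delta, P4.Delta}. lattice_polytope P \<and> aff_dim P = int d"
      using P1.lattice_polytope_Delta P2.lattice_polytope_Delta P3.lattice_polytope_Delta
        P4.lattice_polytope_Delta P1.aff_dim_Delta P2.aff_dim_Delta P3.aff_dim_Delta P4.aff_dim_Delta
      unfolding I by blast
    show "ehrhart_positive P1.Delta" "ehrhart_positive P2.Delta"
      by (rule P1.ehrhart_positive_Delta_small P2.ehrhart_positive_Delta_small; simp)+
    show "\<not> ehrhart_positive P3.Delta" "\<not> ehrhart_positive P4.Delta"
      using N3(2) N4(2) P3.not_ehrhart_positive_Delta P4.not_ehrhart_positive_Delta
      unfolding I by blast+
    show "ehrhart_unimodal P1.Delta" "\<not> ehrhart_unimodal P2.Delta" "ehrhart_unimodal P3.Delta"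
      "\<not> ehrhart_unimodal P4.Delta"
      using N4(1) unfolding P1.ehrhart_unimodal_Delta P2.ehrhart_unimodal_Delta
        P3.ehrhart_unimodal_Delta P4.ehrhart_unimodal_Delta by simp_all
  qed
qed

end
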